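(* Let $f\colon\mathbb{R}^d\to\mathbb{R}$ be differentiable, $B$-Lipschitz and $L$-smooth, and let $\tau>0$. For $x,m,u\in\mathbb{R}^d$ define $$G(x,m;u):=m+\frac{f(x+\tau u)-f(x)-\langle m,\tau u\rangle}{\tau}\,u .$$ Then for all $x,m\in\mathbb{R}^d$, $\mathbb{E}_{u\sim\mathcal{N}(0,I_d)}[G(x,m;u)]=\nabla f^{\tau}(x)$, where $f^{\tau}(x):=\mathbb{E}_{u\sim\mathcal{N}(0,I_d)}[f(x+\tau u)]$. Moreover, $$\mathbb{E}_{u\sim\mathcal{N}(0,I_d)}\big[\|G(x,m;u)-\nabla f(x)\|^2\big]\le 2(d+1)\,\|m-\nabla f(x)\|^2+8\,\tau^2L^2d^3 .$$
   Context: Norms are Euclidean, $d\in\mathbb{N}$. $f$ is $B$-Lipschitz means $\|\nabla f(x)\|\le B$ for all $x$; $L$-smooth means $|f(y)-f(x)-\langle\nabla f(x),y-x\rangle|\le\frac L2\|y-x\|^2$ for all $x,y\in\mathbb{R}^d$. *)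

theory Defs
  imports "HOL-Probability.Probability"
begin

definition std_gaussian :: "(real ^ 'n) measure" where
  "std_gaussian = density lborel (\<lambda>u. ennreal (\<Prod>i\<in>UNIV. std_normal_density (u $ i)))"

lemma std_gaussian_density_eq:
  fixes u :: "real ^ 'n"
  shows "(\<Prod>i\<in>UNIV. std_normal_density (u $ i)) =
    (2 * pi) powr (- real CARD('n) / 2) * exp (- (norm u)\<^sup>2 / 2)"
proof -
  have n: "(norm u)\<^sup>2 = (\<Sum>i\<in>UNIV. (u $ i)\<^sup>2)"
    by (simp add: norm_vec_def L2_set_def sum_nonneg)
  have c: "1 / sqrt (2 * pi) = (2 * pi) powr (- 1 / 2)"
    by (simp add: powr_minus_divide powr_half_sqrt)
  have "(\<Prod>i\<in>UNIV. std_normal_density (u $ i)) =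
      (1 / sqrt (2 * pi)) ^ CARD('n) * exp (\<Sum>i\<in>UNIV. - (u $ i)\<^sup>2 / 2)"
    unfolding std_normal_density_def prod.distrib by (simp add: exp_sum)
  also have "(\<Sum>i\<in>UNIV. - (u $ i)\<^sup>2 / 2) = - (norm u)\<^sup>2 / 2"
    unfolding n by (simp add: sum_negf sum_divide_distrib)
  also have "(1 / sqrt (2 * pi)) ^ CARD('n) = (2 * pi) powr (- real CARD('n) / 2)"
  proof -
    have "((2 * pi) powr (- 1 / 2)) ^ CARD('n) = ((2 * pi) powr (- 1 / 2)) powr real CARD('n)"
      by (rule powr_realpow[symmetric]) simp
    then show ?thesis unfolding c by (simp add: powr_powr)
  qed
  finally show ?thesis .
qed

text \<open>Meaningful only where \<open>f\<close> is differentiable; elsewhere \<open>THE\<close> returns an unspecified value.\<close>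
definition grad :: "('a::real_inner \<Rightarrow> real) \<Rightarrow> 'a \<Rightarrow> 'a" where
  "grad f x = (THE D. GDERIV f x :> D)"

lemma grad_eqI: "GDERIV f x :> D \<Longrightarrow> grad f x = D"
  unfolding grad_def
proof (rule the_equality)
  fix E assume "GDERIV f x :> D" "GDERIV f x :> E"
  then have "(\<lambda>h. h \<bullet> E) = (\<lambda>h. h \<bullet> D)"
    unfolding gderiv_def by (metis has_derivative_unique)
  then have "\<forall>h. h \<bullet> E = h \<bullet> D" by meson
  then show "E = D" by (simp only: vector_eq_ldot)
qed

lemma grad_works:
  fixes f :: "'a::euclidean_space \<Rightarrow> real"
  assumes "f differentiable (at x)"
  shows "GDERIV f x :> grad f x"
proof -
  from assms obtain f' where f': "(f has_derivative f') (at x)"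
    by (auto simp: differentiable_def)
  then interpret f': bounded_linear f' by (rule has_derivative_bounded_linear)
  have "f' = (\<lambda>h. h \<bullet> adjoint f' 1)"
    using adjoint_works[OF f'.linear_axioms, of _ 1] by (simp add: fun_eq_iff)
  with f' have "GDERIV f x :> adjoint f' 1" by (simp add: gderiv_def)
  then show ?thesis by (simp add: grad_eqI)
qed

definition B_Lipschitz :: "real \<Rightarrow> ('a::real_inner \<Rightarrow> real) \<Rightarrow> bool" where
  "B_Lipschitz B f \<longleftrightarrow> (\<forall>x. norm (grad f x) \<le> B)"

definition L_smooth :: "real \<Rightarrow> ('a::real_inner \<Rightarrow> real) \<Rightarrow> bool" where
  "L_smooth L f \<longleftrightarrow>
     (\<forall>x y. \<bar>f y - f x - grad f x \<bullet> (y - x)\<bar> \<le> L / 2 * (norm (y - x))\<^sup>2)"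

definition G_est :: "('a::real_inner \<Rightarrow> real) \<Rightarrow> real \<Rightarrow> 'a \<Rightarrow> 'a \<Rightarrow> 'a \<Rightarrow> 'a" where
  "G_est f \<tau> x m u = m + ((f (x + \<tau> *\<^sub>R u) - f x - m \<bullet> (\<tau> *\<^sub>R u)) / \<tau>) *\<^sub>R u"

definition gauss_smoothing :: "(real ^ 'n \<Rightarrow> real) \<Rightarrow> real \<Rightarrow> real ^ 'n \<Rightarrow> real" where
  "gauss_smoothing f \<tau> x = (LINT u|std_gaussian. f (x + \<tau> *\<^sub>R u))"

end

theory Submission
  imports Defs
begin

text \<open>
  Everything rests on translating the Gaussian. For \<open>g\<close> of at most exponential growth,
  \<open>E g(u + w) = E g(u) exp(\<langle>w,u\<rangle> - |w|^2/2)\<close>, and expanding the exponential to first order in \<open>w\<close>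
  gives \<open>E [g(u) u]\<close> as the gradient of \<open>w \<mapsto> E g(u + w)\<close> at \<open>0\<close>, with no regularity
  required of \<open>g\<close>. Taking \<open>g(u) = f(x + \<tau>u)\<close> shows that the smoothing is differentiable with gradient
  \<open>E [f(x + \<tau>u) u]/\<tau>\<close>, which is the mean of the estimator because \<open>E u = 0\<close> and
  \<open>E [\<langle>m,u\<rangle>u] = m\<close>. Taking \<open>g\<close> polynomial, where \<open>E g(u + hv)\<close> is a polynomial in \<open>h\<close>,
  yields the moments.

  With \<open>v = m - \<nabla>f(x)\<close>, the error of the estimator is \<open>(v - \<langle>v,u\<rangle>u) + r(u)u\<close>, where smoothness
  gives \<open>|r(u)| \<le> \<tau>L|u|^2/2\<close>. The second moment of the first term is exactly \<open>(d + 1)|v|^2\<close>;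
  that of the second is at most \<open>\<tau>^2 L^2 E|u|^6 / 4\<close>, and \<open>E|u|^6 \<le> d^2 \<Sum>i. E u_i^6 = 15 d^3\<close>.
\<close>

subsection \<open>Functions of at most exponential growth\<close>

text \<open>A class that contains the polynomials, is closed under sums, products and affine
  substitution, and is integrable against the Gaussian. Integrability goals thus reduce to applying
  closure rules.\<close>

definition exp_bounded :: "('a::real_normed_vector \<Rightarrow> 'b::real_normed_vector) \<Rightarrow> bool" where
  "exp_bounded g \<longleftrightarrow> (\<exists>C c. \<forall>u. norm (g u) \<le> C * exp (c * norm u))"

lemma exp_boundedI: "(\<And>u. norm (g u) \<le> C * exp (c * norm u)) \<Longrightarrow> exp_bounded g"
  unfolding exp_bounded_def by blast

text \<open>The definition leaves the signs of \<open>C\<close> and \<open>c\<close> open; passing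
  to absolute values gives the nonnegative constants that the monotonicity arguments need.\<close>

lemma exp_boundedE:
  assumes "exp_bounded g"
  obtains C c where "C \<ge> 0" "c \<ge> 0" "\<And>u. norm (g u) \<le> C * exp (c * norm u)"
proof -
  from assms obtain C c where C: "\<And>u. norm (g u) \<le> C * exp (c * norm u)"
    unfolding exp_bounded_def by blast
  have "norm (g u) \<le> \<bar>C\<bar> * exp (\<bar>c\<bar> * norm u)" for u
  proof -
    have "C * exp (c * norm u) \<le> \<bar>C\<bar> * exp (\<bar>c\<bar> * norm u)"
      by (intro mult_mono) (auto intro!: mult_right_mono)
    with C[of u] show ?thesis by linarith
  qed
  then show thesis by (rule that[rotated 2]) auto
qed

lemma exp_bounded_mono:
  "exp_bounded g \<Longrightarrow> (\<And>u. norm (f u) \<le> norm (g u)) \<Longrightarrow> exp_bounded f"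
  unfolding exp_bounded_def by (meson order_trans)

lemma exp_bounded_const: "exp_bounded (\<lambda>_. a)"
  by (rule exp_boundedI[where C = "norm a" and c = 0]) simp

lemma exp_bounded_ident: "exp_bounded (\<lambda>u. u)"
proof (rule exp_boundedI)
  show "norm u \<le> 1 * exp (1 * norm u)" for u :: 'a
    using exp_ge_add_one_self[of "norm u"] by (simp del: exp_ge_add_one_self)
qed

lemma exp_bounded_norm: "exp_bounded g \<Longrightarrow> exp_bounded (\<lambda>u. norm (g u))"
  unfolding exp_bounded_def by simp

lemma exp_bounded_add:
  fixes f g :: "'a::real_normed_vector \<Rightarrow> 'b::real_normed_vector"
  assumes "exp_bounded f" "exp_bounded g"
  shows "exp_bounded (\<lambda>u. f u + g u)"
proof -
  obtain C c where f: "C \<ge> 0" "c \<ge> 0" "\<And>u. norm (f u) \<le> C * exp (c * norm u)"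
    using exp_boundedE[OF assms(1)] by blast
  obtain D d where g: "D \<ge> 0" "d \<ge> 0" "\<And>u. norm (g u) \<le> D * exp (d * norm u)"
    using exp_boundedE[OF assms(2)] by blast
  show ?thesis
  proof (rule exp_boundedI)
    fix u :: 'a
    have "C * exp (c * norm u) \<le> C * exp ((c + d) * norm u)"
      "D * exp (d * norm u) \<le> D * exp ((c + d) * norm u)"
      using f g by (auto intro!: mult_left_mono mult_right_mono)
    then show "norm (f u + g u) \<le> (C + D) * exp ((c + d) * norm u)"
      using norm_triangle_ineq[of "f u" "g u"] f(3)[of u] g(3)[of u]
      by (simp add: distrib_right)
  qed
qed

lemma exp_bounded_scaleR:
  fixes f :: "'a::real_normed_vector \<Rightarrow> real" and g :: "'a \<Rightarrow> 'b::real_normed_vector"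
  assumes "exp_bounded f" "exp_bounded g"
  shows "exp_bounded (\<lambda>u. f u *\<^sub>R g u)"
proof -
  obtain C c where f: "C \<ge> 0" "c \<ge> 0" "\<And>u. norm (f u) \<le> C * exp (c * norm u)"
    using exp_boundedE[OF assms(1)] by blast
  obtain D d where g: "D \<ge> 0" "d \<ge> 0" "\<And>u. norm (g u) \<le> D * exp (d * norm u)"
    using exp_boundedE[OF assms(2)] by blast
  show ?thesis
  proof (rule exp_boundedI)
    fix u :: 'a
    have "norm (f u) * norm (g u) \<le> (C * exp (c * norm u)) * (D * exp (d * norm u))"
      using f g by (intro mult_mono) auto
    then show "norm (f u *\<^sub>R g u) \<le> (C * D) * exp ((c + d) * norm u)"
      by (simp add: exp_add algebra_simps)
  qed
qed

lemma exp_bounded_mult: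
  fixes f g :: "'a::real_normed_vector \<Rightarrow> real"
  shows "exp_bounded f \<Longrightarrow> exp_bounded g \<Longrightarrow> exp_bounded (\<lambda>u. f u * g u)"
  using exp_bounded_scaleR[of f g] by simp

lemma exp_bounded_minus: "exp_bounded f \<Longrightarrow> exp_bounded (\<lambda>u. - f u)"
  unfolding exp_bounded_def by simp

lemma exp_bounded_diff:
  "exp_bounded f \<Longrightarrow> exp_bounded g \<Longrightarrow> exp_bounded (\<lambda>u. f u - g u)"
  using exp_bounded_add[of f "\<lambda>u. - g u"] exp_bounded_minus[of g] by simp

lemma exp_bounded_power:
  fixes f :: "'a::real_normed_vector \<Rightarrow> real"
  shows "exp_bounded f \<Longrightarrow> exp_bounded (\<lambda>u. f u ^ n)"
  by (induction n) (auto intro: exp_bounded_const exp_bounded_mult)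

lemma exp_bounded_inner:
  assumes "exp_bounded f" "exp_bounded g"
  shows "exp_bounded (\<lambda>u. f u \<bullet> g u)"
  by (rule exp_bounded_mono[OF exp_bounded_mult[OF exp_bounded_norm exp_bounded_norm, OF assms]])
    (simp add: Cauchy_Schwarz_ineq2)

lemma exp_bounded_exp_norm: "exp_bounded (\<lambda>u. exp (c * norm u))"
  by (rule exp_boundedI[where C = 1 and c = c]) simp

lemma exp_bounded_affine:
  fixes a :: "'a::real_normed_vector"
  assumes "exp_bounded g"
  shows "exp_bounded (\<lambda>u. g (a + r *\<^sub>R u))"
proof -
  obtain C c where g: "C \<ge> 0" "c \<ge> 0" "\<And>u. norm (g u) \<le> C * exp (c * norm u)"
    using exp_boundedE[OF assms] by blast
  show ?thesis
  proof (rule exp_boundedI)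
    fix u
    have "norm (g (a + r *\<^sub>R u)) \<le> C * exp (c * norm (a + r *\<^sub>R u))" by (rule g)
    also have "\<dots> \<le> C * exp (c * (norm a + \<bar>r\<bar> * norm u))"
      using g norm_triangle_ineq[of a "r *\<^sub>R u"] by (auto intro!: mult_left_mono)
    also have "\<dots> = (C * exp (c * norm a)) * exp ((c * \<bar>r\<bar>) * norm u)"
      by (simp add: exp_add distrib_left ac_simps)
    finally show "norm (g (a + r *\<^sub>R u)) \<le> (C * exp (c * norm a)) * exp ((c * \<bar>r\<bar>) * norm u)" .
  qed
qed

lemmas exp_bounded_intros = exp_bounded_const exp_bounded_ident exp_bounded_norm exp_bounded_add
  exp_bounded_diff exp_bounded_scaleR exp_bounded_mult exp_bounded_power exp_bounded_inner
  exp_bounded_exp_norm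

subsection \<open>Integration against the standard Gaussian\<close>

abbreviation gauss_dens :: "real ^ 'n \<Rightarrow> real" where
  "gauss_dens u \<equiv> \<Prod>i\<in>UNIV. std_normal_density (u $ i)"

lemma gauss_dens_nonneg: "gauss_dens u \<ge> 0"
  by (simp add: prod_nonneg)

lemma borel_measurable_gauss_dens [measurable]: "gauss_dens \<in> borel_measurable borel"
  unfolding std_gaussian_density_eq by measurable

lemma space_std_gaussian [simp]: "space std_gaussian = UNIV"
  by (simp add: std_gaussian_def)

lemma sets_std_gaussian [simp, measurable_cong]: "sets std_gaussian = sets borel"
  by (simp add: std_gaussian_def)

text \<open>The density is a product over coordinates, so Tonelli reduces the total mass to that of
  the one-dimensional normal law.\<close>

lemma prob_space_std_gaussian: "prob_space (std_gaussian :: (real ^ 'n) measure)"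
proof
  have "emeasure (std_gaussian :: (real ^ 'n) measure) (space std_gaussian) =
      (\<integral>\<^sup>+u. ennreal (gauss_dens (u :: real ^ 'n)) \<partial>lborel)"
    by (simp add: std_gaussian_def emeasure_density)
  also have "\<dots> = (\<integral>\<^sup>+u. (\<Prod>b\<in>Basis. ennreal (std_normal_density ((u :: real ^ 'n) \<bullet> b))) \<partial>lborel)"
  proof (rule nn_integral_cong)
    fix u :: "real ^ 'n"
    \<comment> \<open>\<open>nn_integral_lborel_prod\<close> speaks of products over
      \<open>Basis\<close>, whereas the density is a product over indices; \<open>axis\<close>
      translates between them.\<close>
    have "bij_betw (\<lambda>i. axis i 1) (UNIV :: 'n set) (Basis :: (real ^ 'n) set)"
      by (auto simp: bij_betw_def inj_on_def axis_eq_axis Basis_vec_def)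
    then have "(\<Prod>b\<in>Basis. ennreal (std_normal_density (u \<bullet> b))) =
        (\<Prod>i\<in>UNIV. ennreal (std_normal_density (u $ i)))"
      by (subst prod.reindex_bij_betw[symmetric, where h = "\<lambda>i. axis i 1"])
        (simp_all add: inner_axis)
    also have "\<dots> = ennreal (gauss_dens u)"
      by (rule prod_ennreal) simp
    finally show "ennreal (gauss_dens u) = (\<Prod>b\<in>Basis. ennreal (std_normal_density (u \<bullet> b)))" ..
  qed
  also have "\<dots> = (\<Prod>b\<in>(Basis :: (real ^ 'n) set). \<integral>\<^sup>+s. ennreal (std_normal_density s) \<partial>lborel)"
    by (rule nn_integral_lborel_prod) auto
  also have "(\<integral>\<^sup>+s. ennreal (std_normal_density s) \<partial>lborel) = 1"
    using prob_space.emeasure_space_1[OF prob_space_normal_density[of 1 0]]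
    by (simp add: emeasure_density)
  finally show "emeasure (std_gaussian :: (real ^ 'n) measure) (space std_gaussian) = 1"
    by simp
qed

lemma integral_std_gaussian:
  fixes g :: "real ^ 'n \<Rightarrow> 'b::{banach, second_countable_topology}"
  assumes "g \<in> borel_measurable borel"
  shows "(LINT u|std_gaussian. g u) = (LINT u|lborel. gauss_dens u *\<^sub>R g u)"
  unfolding std_gaussian_def using assms
  by (intro integral_density) (auto simp: gauss_dens_nonneg)

lemma integrable_std_gaussian_iff:
  fixes g :: "real ^ 'n \<Rightarrow> 'b::{banach, second_countable_topology}"
  assumes "g \<in> borel_measurable borel"
  shows "integrable std_gaussian g \<longleftrightarrow> integrable lborel (\<lambda>u. gauss_dens u *\<^sub>R g u)"
  unfolding std_gaussian_def using assms
  by (intro integrable_density) (auto simp: gauss_dens_nonneg)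

text \<open>Lebesgue measure is its own image under scaling up to the Jacobian factor
  \<open>\<bar>c\<bar>^DIM('a)\<close>, which is divided out at the end. It serves to dominate by a
  widened Gaussian density.\<close>

lemma integrable_lborel_scale:
  fixes g :: "'a::euclidean_space \<Rightarrow> 'b::{banach, second_countable_topology}"
  assumes "integrable lborel g" "c \<noteq> 0"
  shows "integrable lborel (\<lambda>u. g (c *\<^sub>R u))"
proof -
  have [measurable]: "g \<in> borel_measurable borel"
    using assms(1) by auto
  have "integrable (density (distr lborel borel (\<lambda>x. 0 + c *\<^sub>R x)) (\<lambda>_. \<bar>c\<bar>^DIM('a))) g"
    using assms lborel_affine[of c "0 :: 'a"] by simp
  then have "integrable (distr lborel borel (\<lambda>x. 0 + c *\<^sub>R x)) (\<lambda>u. (\<bar>c\<bar>^DIM('a)) *\<^sub>R g u)"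
    by (subst (asm) integrable_density) auto
  then have "integrable lborel (\<lambda>u. (\<bar>c\<bar>^DIM('a)) *\<^sub>R g (c *\<^sub>R u))"
    by (subst (asm) integrable_distr_eq) auto
  then have "integrable lborel (\<lambda>u. (1 / \<bar>c\<bar>^DIM('a)) *\<^sub>R ((\<bar>c\<bar>^DIM('a)) *\<^sub>R g (c *\<^sub>R u)))"
    by (rule integrable_scaleR_right)
  moreover have "(\<lambda>u. (1 / \<bar>c\<bar>^DIM('a)) *\<^sub>R ((\<bar>c\<bar>^DIM('a)) *\<^sub>R g (c *\<^sub>R u))) =
      (\<lambda>u. g (c *\<^sub>R u))"
    using assms(2) by simp
  ultimately show ?thesis by (simp only:)
qed

text \<open>Half of the Gaussian exponent absorbs the exponential: what remains is a constant times
  the density at \<open>u / sqrt 2\<close>, which is integrable because the density itself has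
  finite mass.\<close>

lemma integrable_exp_norm_std_gaussian:
  "integrable std_gaussian (\<lambda>u :: real ^ 'n. exp (c * norm u))"
proof -
  interpret prob_space "std_gaussian :: (real ^ 'n) measure"
    by (rule prob_space_std_gaussian)
  have "integrable std_gaussian (\<lambda>u :: real ^ 'n. 1 :: real)" by simp
  then have "integrable lborel (\<lambda>u :: real ^ 'n. gauss_dens u)"
    using integrable_std_gaussian_iff[of "\<lambda>_ :: real ^ 'n. 1 :: real"] by simp
  then have *: "integrable lborel (\<lambda>u :: real ^ 'n. exp (c\<^sup>2) * gauss_dens ((1 / sqrt 2) *\<^sub>R u))"
    by (intro integrable_mult_right integrable_lborel_scale) auto
  have "integrable lborel (\<lambda>u :: real ^ 'n. gauss_dens u *\<^sub>R exp (c * norm u))"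
  proof (rule Bochner_Integration.integrable_bound[OF *], simp, intro AE_I2)
    fix u :: "real ^ 'n"
    \<comment> \<open>This is \<open>(c - norm u / 2)^2 >= 0\<close>, rearranged.\<close>
    have sq: "c * norm u - (norm u)\<^sup>2 / 2 \<le> c\<^sup>2 - (norm u)\<^sup>2 / 4"
      using zero_le_power2[of "c - norm u / 2"] by (simp add: power2_eq_square algebra_simps)
    have "gauss_dens u * exp (c * norm u) =
        (2 * pi) powr (- real CARD('n) / 2) * exp (c * norm u - (norm u)\<^sup>2 / 2)"
      unfolding std_gaussian_density_eq by (simp add: exp_add[symmetric] mult.assoc)
    also have "\<dots> \<le> (2 * pi) powr (- real CARD('n) / 2) * exp (c\<^sup>2 - (norm u)\<^sup>2 / 4)"
      using sq by simp
    also have "\<dots> = exp (c\<^sup>2) * gauss_dens ((1 / sqrt 2) *\<^sub>R u)"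
      unfolding std_gaussian_density_eq
      by (simp add: exp_add[symmetric] mult.assoc mult.left_commute power_divide)
    finally show "norm (gauss_dens u *\<^sub>R exp (c * norm u))
        \<le> norm (exp (c\<^sup>2) * gauss_dens ((1 / sqrt 2) *\<^sub>R u))"
      by (simp add: abs_mult gauss_dens_nonneg prod_nonneg)
  qed
  then show ?thesis by (subst integrable_std_gaussian_iff) auto
qed

lemma integrable_exp_bounded:
  fixes g :: "real ^ 'n \<Rightarrow> 'b::{banach, second_countable_topology}"
  assumes "g \<in> borel_measurable borel" "exp_bounded g"
  shows "integrable std_gaussian g"
proof -
  obtain C c where g: "C \<ge> 0" "c \<ge> 0" "\<And>u. norm (g u) \<le> C * exp (c * norm u)"
    using exp_boundedE[OF assms(2)] by blast
  have *: "integrable std_gaussian (\<lambda>u :: real ^ 'n. C * exp (c * norm u))"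
    by (intro integrable_mult_right integrable_exp_norm_std_gaussian)
  show ?thesis
    by (rule Bochner_Integration.integrable_bound[OF *]) (use assms(1) g in \<open>auto simp: abs_mult\<close>)
qed

text \<open>The Cameron-Martin formula: translation invariance of Lebesgue measure moves the shift
  onto the density, and the exponential is the ratio of the two densities.\<close>

lemma std_gaussian_shift:
  fixes g :: "real ^ 'n \<Rightarrow> real"
  assumes [measurable]: "g \<in> borel_measurable borel"
  shows "(LINT u|std_gaussian. g (u + w)) =
    (LINT u|std_gaussian. g u * exp (w \<bullet> u - (norm w)\<^sup>2 / 2))"
proof -
  \<comment> \<open>Writing \<open>(w + u) - w\<close> makes the whole integrand a function of
    \<open>w + u\<close>, so that it is an integral against the image measure under
    \<open>(+) w\<close>.\<close>
  have "(LINT u|std_gaussian. g (u + w)) = (LINT u|lborel. gauss_dens ((w + u) - w) * g (w + u))"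
    by (simp add: integral_std_gaussian add.commute)
  also have "\<dots> = (LINT u|distr lborel borel ((+) w). gauss_dens (u - w) * g u)"
    by (simp add: integral_distr del: vector_minus_component)
  also have "\<dots> = (LINT u|lborel. gauss_dens u * (g u * exp (w \<bullet> u - (norm w)\<^sup>2 / 2)))"
    unfolding lborel_distr_plus
  proof (rule Bochner_Integration.integral_cong[OF refl])
    fix u :: "real ^ 'n"
    have "- (norm (u - w))\<^sup>2 / 2 = - (norm u)\<^sup>2 / 2 + (w \<bullet> u - (norm w)\<^sup>2 / 2)"
      by (simp add: power2_norm_eq_inner inner_diff inner_commute field_simps)
    then have "exp (- (norm (u - w))\<^sup>2 / 2) =
        exp (- (norm u)\<^sup>2 / 2) * exp (w \<bullet> u - (norm w)\<^sup>2 / 2)"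
      by (simp add: exp_add[symmetric])
    then show "gauss_dens (u - w) * g u = gauss_dens u * (g u * exp (w \<bullet> u - (norm w)\<^sup>2 / 2))"
      unfolding std_gaussian_density_eq by simp
  qed
  also have "\<dots> = (LINT u|std_gaussian. g u * exp (w \<bullet> u - (norm w)\<^sup>2 / 2))"
    by (simp add: integral_std_gaussian)
  finally show ?thesis .
qed

subsection \<open>Differentiating Gaussian translates\<close>

text \<open>Taylor expansion with Lagrange remainder; the intermediate point is at most
  \<open>\<bar>t\<bar>\<close> in absolute value, whatever the sign of \<open>t\<close>.\<close>

lemma abs_exp_remainder_le: "\<bar>exp t - 1 - t\<bar> \<le> t\<^sup>2 * exp \<bar>t\<bar>" for t :: real
proof -
  obtain s where s: "\<bar>s\<bar> \<le> \<bar>t\<bar>" "exp t = (\<Sum>m<2. t ^ m / fact m) + exp s / fact 2 * t ^ 2"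
    using Maclaurin_exp_le[of t 2] by blast
  have "\<bar>exp t - 1 - t\<bar> = exp s / 2 * t\<^sup>2"
    using s(2) by (simp add: numeral_2_eq_2)
  also have "\<dots> \<le> exp \<bar>t\<bar> * t\<^sup>2"
  proof (rule mult_right_mono)
    have "exp s \<le> exp \<bar>t\<bar>" using s(1) by simp
    then show "exp s / 2 \<le> exp \<bar>t\<bar>" using exp_gt_zero[of s] by linarith
  qed simp
  finally show ?thesis by (simp add: mult.commute)
qed

text \<open>The difference quotient is at most \<open>C * norm w\<close>. Control on the unit ball
  is enough, and there the Gaussian remainder below has a bound with a constant independent of
  \<open>w\<close>.\<close>

lemma GDERIV_quadratic_remainder:
  fixes F :: "'a::real_inner \<Rightarrow> real"
  assumes "\<And>w. norm w \<le> 1 \<Longrightarrow> \<bar>F w - F 0 - w \<bullet> D\<bar> \<le> C * (norm w)\<^sup>2"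
  shows "GDERIV F 0 :> D"
  unfolding gderiv_def has_derivative_at2
proof (intro conjI)
  show "bounded_linear (\<lambda>h. h \<bullet> D)" by (rule bounded_linear_inner_left)
  have "((\<lambda>w::'a. C * norm w) \<longlongrightarrow> C * norm (0::'a)) (at 0)"
    by (intro tendsto_intros)
  then have lim: "((\<lambda>w::'a. C * norm w) \<longlongrightarrow> 0) (at 0)" by simp
  show "((\<lambda>w. (1 / norm (w - 0)) *\<^sub>R (F w - (F 0 + (w - 0) \<bullet> D))) \<longlongrightarrow> 0) (at 0)"
  proof (rule Lim_null_comparison[OF _ lim])
    have "\<forall>\<^sub>F w :: 'a in at 0. dist w 0 < 1"
      by (auto simp: eventually_at intro: exI[where x = 1])
    then show "\<forall>\<^sub>F w in at 0.
        norm ((1 / norm (w - 0)) *\<^sub>R (F w - (F 0 + (w - 0) \<bullet> D))) \<le> C * norm w"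
    proof eventually_elim
      case (elim w)
      then have "\<bar>F w - F 0 - w \<bullet> D\<bar> \<le> C * (norm w)\<^sup>2" using assms by simp
      then show ?case
        by (cases "w = 0") (simp_all add: divide_simps power2_eq_square algebra_simps)
    qed
  qed
qed

text \<open>After the change of measure the dependence on \<open>w\<close> sits in the exponential
  weight alone. Its first-order remainder is at most \<open>(norm w)^2 * K u\<close>, and
  \<open>K\<close> has exponential growth, so the bound survives integration against
  \<open>g\<close>.\<close>

lemma GDERIV_std_gaussian_shift:
  fixes g :: "real ^ 'n \<Rightarrow> real"
  assumes [measurable]: "g \<in> borel_measurable borel" and g: "exp_bounded g"
  shows "GDERIV (\<lambda>w. LINT u|std_gaussian. g (u + w)) 0 :> (LINT u|std_gaussian. g u *\<^sub>R u)"
proof (rule GDERIV_quadratic_remainder)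
  \<comment> \<open>With \<open>t\<close> the exponent of the weight, the first summand comes from
    \<open>t^2 * exp \<bar>t\<bar>\<close> and the bounds \<open>norm w * (norm u + 1)\<close> and
    \<open>norm u + 1\<close> on \<open>\<bar>t\<bar>\<close>; the \<open>1 / 2\<close> pays for the
    term \<open>(norm w)^2 / 2\<close> inside \<open>t\<close>. The factor
    \<open>exp (1 * norm u)\<close> is spelled to match \<open>exp_bounded_exp_norm\<close>.\<close>
  define K :: "real ^ 'n \<Rightarrow> real"
    where "K u = (norm u + 1)\<^sup>2 * (exp 1 * exp (1 * norm u)) + 1 / 2" for u
  have K_meas [measurable]: "K \<in> borel_measurable borel"
    unfolding K_def by measurable
  have K: "exp_bounded K"
    unfolding K_def[abs_def] by (intro exp_bounded_intros)
  have int_K: "integrable std_gaussian (\<lambda>u. norm (g u) * K u)"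
    by (intro integrable_exp_bounded exp_bounded_intros g K) measurable
  have int_g: "integrable std_gaussian g"
    by (intro integrable_exp_bounded g) measurable
  have int_gu: "integrable std_gaussian (\<lambda>u. g u *\<^sub>R u)"
    by (intro integrable_exp_bounded exp_bounded_intros g) measurable
  fix w :: "real ^ 'n" assume w: "norm w \<le> 1"
  have int_wgu: "integrable std_gaussian (\<lambda>u. g u * (w \<bullet> u))"
    by (intro integrable_exp_bounded exp_bounded_intros g) measurable
  have w_gu: "w \<bullet> (LINT u|std_gaussian. g u *\<^sub>R u) = (LINT u|std_gaussian. g u * (w \<bullet> u))"
    using int_gu by (subst integral_inner_right[symmetric]) simp_all
  have int_e: "integrable std_gaussian (\<lambda>u. g u * exp (w \<bullet> u - (norm w)\<^sup>2 / 2))"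
  proof (intro integrable_exp_bounded exp_bounded_mult g)
    show "exp_bounded (\<lambda>u. exp (w \<bullet> u - (norm w)\<^sup>2 / 2))"
    proof (rule exp_bounded_mono[OF exp_bounded_exp_norm])
      fix u
      show "norm (exp (w \<bullet> u - (norm w)\<^sup>2 / 2)) \<le> norm (exp (norm w * norm u))"
        using norm_cauchy_schwarz[of w u] by (simp add: add_increasing2 algebra_simps)
    qed
  qed measurable
  have "(LINT u|std_gaussian. g (u + w)) - (LINT u|std_gaussian. g (u + 0))
      - w \<bullet> (LINT u|std_gaussian. g u *\<^sub>R u)
    = (LINT u|std_gaussian. g u * exp (w \<bullet> u - (norm w)\<^sup>2 / 2) - g u - w \<bullet> (g u *\<^sub>R u))"
    using int_e int_g int_wgu w_gu by (simp add: std_gaussian_shift[OF assms(1), of w])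
  also have "\<bar>\<dots>\<bar> \<le> (LINT u|std_gaussian. (norm w)\<^sup>2 * (norm (g u) * K u))"
  proof (rule order_trans[OF integral_abs_bound], rule integral_mono)
    show "integrable std_gaussian
        (\<lambda>u. \<bar>g u * exp (w \<bullet> u - (norm w)\<^sup>2 / 2) - g u - w \<bullet> (g u *\<^sub>R u)\<bar>)"
      using int_e int_g int_gu
      by (intro integrable_abs Bochner_Integration.integrable_diff integrable_inner_right) auto
    show "integrable std_gaussian (\<lambda>u. (norm w)\<^sup>2 * (norm (g u) * K u))"
      using int_K by simp
    fix u :: "real ^ 'n"
    define t where "t = w \<bullet> u - (norm w)\<^sup>2 / 2"
    have "(norm w)\<^sup>2 \<le> norm w"
      using w by (simp add: power2_eq_square mult_left_le)
    then have t1: "\<bar>t\<bar> \<le> norm w * (norm u + 1)"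
      unfolding t_def distrib_left mult_1_right
      using Cauchy_Schwarz_ineq2[of w u] zero_le_power2[of "norm w"] by linarith
    have t2: "\<bar>t\<bar> \<le> 1 * (norm u + 1)"
      using t1 w norm_ge_zero[of u] mult_right_mono[of "norm w" 1 "norm u + 1"] by linarith
    have "\<bar>exp t - 1 - w \<bullet> u\<bar> \<le> \<bar>exp t - 1 - t\<bar> + (norm w)\<^sup>2 / 2"
      unfolding t_def using zero_le_power2[of "norm w"] by linarith
    also have "\<dots> \<le> t\<^sup>2 * exp \<bar>t\<bar> + (norm w)\<^sup>2 / 2"
      using abs_exp_remainder_le[of t] by simp
    also have "t\<^sup>2 * exp \<bar>t\<bar> \<le> (norm w * (norm u + 1))\<^sup>2 * exp (norm u + 1)"
      using t1 t2 by (intro mult_mono) (auto simp: abs_le_square_iff[symmetric])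
    also have "\<dots> + (norm w)\<^sup>2 / 2 = (norm w)\<^sup>2 * K u"
      unfolding K_def power_mult_distrib exp_add by (simp add: algebra_simps)
    finally have "\<bar>exp t - 1 - w \<bullet> u\<bar> \<le> (norm w)\<^sup>2 * K u" by simp
    then have "\<bar>g u\<bar> * \<bar>exp t - 1 - w \<bullet> u\<bar> \<le> \<bar>g u\<bar> * ((norm w)\<^sup>2 * K u)"
      by (rule mult_left_mono) simp
    then show "\<bar>g u * exp (w \<bullet> u - (norm w)\<^sup>2 / 2) - g u - w \<bullet> (g u *\<^sub>R u)\<bar>
        \<le> (norm w)\<^sup>2 * (norm (g u) * K u)"
      unfolding t_def[symmetric] abs_mult[symmetric] by (simp add: algebra_simps)
  qed
  finally show "\<bar>(LINT u|std_gaussian. g (u + w)) - (LINT u|std_gaussian. g (u + 0))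
      - w \<bullet> (LINT u|std_gaussian. g u *\<^sub>R u)\<bar>
    \<le> (LINT u|std_gaussian. norm (g u) * K u) * (norm w)\<^sup>2"
    by (simp add: mult.commute)
qed


text \<open>The chain rule along the line through \<open>v\<close>. In this one-variable form,
  uniqueness of derivatives can compare the result with an explicit polynomial in
  \<open>h\<close>.\<close>

lemma DERIV_std_gaussian_shift:
  fixes g :: "real ^ 'n \<Rightarrow> real"
  assumes [measurable]: "g \<in> borel_measurable borel" and g: "exp_bounded g"
  shows "DERIV (\<lambda>h. LINT u|std_gaussian. g (u + h *\<^sub>R v)) 0 :>
    (LINT u|std_gaussian. g u * (v \<bullet> u))"
proof -
  have int: "integrable std_gaussian (\<lambda>u. g u *\<^sub>R u)"
    by (intro integrable_exp_bounded exp_bounded_intros g) measurable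
  have "((\<lambda>h. h *\<^sub>R v) has_derivative (\<lambda>h. h *\<^sub>R v)) (at 0)"
    by (auto intro!: derivative_eq_intros)
  moreover have "((\<lambda>w. LINT u|std_gaussian. g (u + w)) has_derivative
      (\<lambda>w. w \<bullet> (LINT u|std_gaussian. g u *\<^sub>R u))) (at ((\<lambda>h :: real. h *\<^sub>R v) 0))"
    using GDERIV_std_gaussian_shift[OF assms] by (simp add: gderiv_def)
  ultimately have "((\<lambda>h. LINT u|std_gaussian. g (u + h *\<^sub>R v)) has_derivative
      (\<lambda>h. (h *\<^sub>R v) \<bullet> (LINT u|std_gaussian. g u *\<^sub>R u))) (at 0)"
    by (rule has_derivative_compose)
  moreover have "v \<bullet> (LINT u|std_gaussian. g u *\<^sub>R u) = (LINT u|std_gaussian. g u * (v \<bullet> u))"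
    using int by (subst integral_inner_right[symmetric]) simp_all
  ultimately show ?thesis
    by (simp add: has_field_derivative_def mult_commute_abs)
qed

subsection \<open>Gaussian moments\<close>

text \<open>Beyond the linear term every summand carries a factor \<open>h^2\<close>. The upper
  limit \<open>Suc k\<close> ensures that the linear term is present.\<close>

lemma DERIV_poly_at_0:
  fixes a :: "nat \<Rightarrow> real"
  shows "DERIV (\<lambda>h. \<Sum>j\<le>Suc k. a j * h ^ j) 0 :> a 1"
proof -
  have "DERIV (\<lambda>h. a 0 + a 1 * h + (\<Sum>j<k. a (Suc (Suc j)) * h ^ Suc (Suc j))) 0 :>
      0 + a 1 + (\<Sum>j<k. 0)"
    by (intro derivative_intros DERIV_sum) (auto intro!: derivative_eq_intros)
  then show ?thesis
    by (simp add: sum.atMost_Suc_shift lessThan_Suc_atMost[symmetric] sum.lessThan_Suc_shift add.assoc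
        del: sum.lessThan_Suc sum.atMost_Suc)
qed

text \<open>The constant function 1 has constant translates, so the derivative of their mean
  vanishes.\<close>

lemma std_gaussian_moment_1: "(LINT u|std_gaussian. v \<bullet> u) = 0" for v :: "real ^ 'n"
proof -
  interpret prob_space "std_gaussian :: (real ^ 'n) measure" by (rule prob_space_std_gaussian)
  have "DERIV (\<lambda>h. 1 :: real) 0 :> (LINT u|std_gaussian. 1 * (v \<bullet> u))"
    using DERIV_std_gaussian_shift[of "\<lambda>_. 1" v] prob_space
    by (simp add: exp_bounded_const)
  then show ?thesis
    using DERIV_unique[OF _ DERIV_const] by fastforce
qed

text \<open>Translating by \<open>h *\<^sub>R v\<close> turns \<open>v \<bullet> u\<close> into
  \<open>v \<bullet> u + h * (norm v)^2\<close>. The derivative at 0 of the mean of its power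
  \<open>Suc k\<close> is computed twice: as the linear coefficient of the binomial expansion, and
  by \<open>DERIV_std_gaussian_shift\<close>.\<close>

lemma std_gaussian_moment_Suc_Suc:
  fixes v :: "real ^ 'n"
  shows "(LINT u|std_gaussian. (v \<bullet> u) ^ Suc (Suc k)) =
    real (Suc k) * (norm v)\<^sup>2 * (LINT u|std_gaussian. (v \<bullet> u) ^ k)"
proof -
  let ?a = "\<lambda>j. real (Suc k choose j) * ((norm v)\<^sup>2) ^ j * (LINT u|std_gaussian. (v \<bullet> u) ^ (Suc k - j))"
  have int: "integrable std_gaussian (\<lambda>u. (v \<bullet> u) ^ j)" for j
    by (intro integrable_exp_bounded exp_bounded_intros) measurable
  have "(LINT u|std_gaussian. (v \<bullet> (u + h *\<^sub>R v)) ^ Suc k) = (\<Sum>j\<le>Suc k. ?a j * h ^ j)" for h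
  proof -
    have "(v \<bullet> (u + h *\<^sub>R v)) ^ Suc k = (\<Sum>j\<le>Suc k. (real (Suc k choose j) * ((norm v)\<^sup>2) ^ j
        * h ^ j) * (v \<bullet> u) ^ (Suc k - j))" for u
      using binomial_ring[of "h * (v \<bullet> v)" "v \<bullet> u" "Suc k"]
      by (simp add: inner_add_right dot_square_norm power_mult_distrib ac_simps
          del: power_Suc binomial_Suc_Suc sum.atMost_Suc)
    then have "(LINT u|std_gaussian. (v \<bullet> (u + h *\<^sub>R v)) ^ Suc k) = (LINT u|std_gaussian.
        (\<Sum>j\<le>Suc k. (real (Suc k choose j) * ((norm v)\<^sup>2) ^ j * h ^ j) * (v \<bullet> u) ^ (Suc k - j)))"
      by simp
    also have "\<dots> = (\<Sum>j\<le>Suc k. LINT u|std_gaussian.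
        (real (Suc k choose j) * ((norm v)\<^sup>2) ^ j * h ^ j) * (v \<bullet> u) ^ (Suc k - j))"
      by (intro Bochner_Integration.integral_sum integrable_mult_right int)
    also have "\<dots> = (\<Sum>j\<le>Suc k. ?a j * h ^ j)"
      by (intro sum.cong refl) (simp del: power_Suc binomial_Suc_Suc)
    finally show ?thesis .
  qed
  then have "DERIV (\<lambda>h. LINT u|std_gaussian. (v \<bullet> (u + h *\<^sub>R v)) ^ Suc k) 0 :> ?a 1"
    using DERIV_poly_at_0[of ?a k] by presburger
  moreover have "DERIV (\<lambda>h. LINT u|std_gaussian. (v \<bullet> (u + h *\<^sub>R v)) ^ Suc k) 0 :>
      (LINT u|std_gaussian. (v \<bullet> u) ^ Suc k * (v \<bullet> u))"
    by (intro DERIV_std_gaussian_shift exp_bounded_intros) measurable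
  ultimately have "(LINT u|std_gaussian. (v \<bullet> u) ^ Suc k * (v \<bullet> u)) = ?a 1"
    by (rule DERIV_unique[rotated])
  then show ?thesis by (simp add: ac_simps)
qed

lemma std_gaussian_moment_2: "(LINT u|std_gaussian. (v \<bullet> u)\<^sup>2) = (norm v)\<^sup>2" for v :: "real ^ 'n"
  using std_gaussian_moment_Suc_Suc[of v 0]
    prob_space.prob_space[OF prob_space_std_gaussian[where 'n = 'n]]
  by (simp add: numeral_2_eq_2)

text \<open>The recursion goes from 6 to 4 to 2; the constant is 15 = 5 * 3 * 1.\<close>

lemma std_gaussian_moment_6:
  "(LINT u|std_gaussian. (v \<bullet> u) ^ 6) = 15 * (norm v) ^ 6" for v :: "real ^ 'n"
proof -
  have "(LINT u|std_gaussian. (v \<bullet> u) ^ 6) =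
      5 * (norm v)\<^sup>2 * (3 * (norm v)\<^sup>2 * (LINT u|std_gaussian. (v \<bullet> u)\<^sup>2))"
    using std_gaussian_moment_Suc_Suc[of v 4] std_gaussian_moment_Suc_Suc[of v 2]
    by (simp add: eval_nat_numeral)
  then show ?thesis
    unfolding std_gaussian_moment_2 by (simp add: eval_nat_numeral)
qed

text \<open>Since \<open>v \<bullet> u\<close> has mean zero, the mean of its translate along
  \<open>w\<close> is exactly linear in \<open>h\<close>, with slope
  \<open>v \<bullet> w\<close>.\<close>

lemma std_gaussian_covariance:
  "(LINT u|std_gaussian. (v \<bullet> u) * (w \<bullet> u)) = v \<bullet> w" for v w :: "real ^ 'n"
proof -
  have int: "integrable std_gaussian (\<lambda>u. v \<bullet> u)"
    by (intro integrable_exp_bounded exp_bounded_intros) measurable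
  interpret prob_space "std_gaussian :: (real ^ 'n) measure" by (rule prob_space_std_gaussian)
  have "(LINT u|std_gaussian. v \<bullet> (u + h *\<^sub>R w)) = h * (v \<bullet> w)" for h
    using int prob_space by (simp add: inner_add_right std_gaussian_moment_1)
  moreover have "DERIV (\<lambda>h. LINT u|std_gaussian. v \<bullet> (u + h *\<^sub>R w)) 0 :>
      (LINT u|std_gaussian. (v \<bullet> u) * (w \<bullet> u))"
    by (intro DERIV_std_gaussian_shift exp_bounded_intros) measurable
  moreover have "DERIV (\<lambda>h. h * (v \<bullet> w)) 0 :> v \<bullet> w"
    by (auto intro!: derivative_eq_intros)
  ultimately show ?thesis
    using DERIV_unique by fastforce
qed

text \<open>Coordinates appear as inner products with unit vectors so that the moment formulas for
  \<open>v \<bullet> u\<close> apply to them.\<close>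

lemma norm_power2_vec: "(norm u)\<^sup>2 = (\<Sum>i\<in>UNIV. (axis i 1 \<bullet> u)\<^sup>2)" for u :: "real ^ 'n"
  by (simp add: norm_vec_def L2_set_def sum_nonneg inner_axis')

lemma std_gaussian_norm_power2:
  "(LINT u|std_gaussian. (norm (u :: real ^ 'n))\<^sup>2) = real CARD('n)"
proof -
  have "(LINT u|std_gaussian. (norm (u :: real ^ 'n))\<^sup>2) =
      (\<Sum>i\<in>UNIV. LINT u|std_gaussian. (axis i 1 \<bullet> (u :: real ^ 'n))\<^sup>2)"
    unfolding norm_power2_vec
    by (intro Bochner_Integration.integral_sum integrable_exp_bounded exp_bounded_intros) measurable
  then show ?thesis by (simp add: std_gaussian_moment_2)
qed

text \<open>Jensen's inequality for the cube on the nonnegative reals, with equal weights.\<close>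

lemma sum_cubed_le:
  fixes a :: "'i \<Rightarrow> real"
  assumes "finite I" "I \<noteq> {}" "\<And>i. i \<in> I \<Longrightarrow> a i \<ge> 0"
  shows "(\<Sum>i\<in>I. a i) ^ 3 \<le> (real (card I))\<^sup>2 * (\<Sum>i\<in>I. a i ^ 3)"
proof -
  have n: "real (card I) > 0" using assms(1,2) by (simp add: card_gt_0_iff)
  have "(\<Sum>i\<in>I. (1 / real (card I)) *\<^sub>R a i) ^ 3 \<le> (\<Sum>i\<in>I. (1 / real (card I)) * a i ^ 3)"
    using assms n by (intro convex_on_sum[of I "{0..}" "\<lambda>x. x ^ 3"] convex_power_odd) auto
  then have "((\<Sum>i\<in>I. a i) / real (card I)) ^ 3 \<le> (\<Sum>i\<in>I. a i ^ 3) / real (card I)"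
    by (simp add: sum_divide_distrib)
  then show ?thesis
    using n by (simp add: field_simps eval_nat_numeral)
qed

lemma std_gaussian_norm_power6_le:
  "(LINT u|std_gaussian. (norm (u :: real ^ 'n)) ^ 6) \<le> 15 * real CARD('n) ^ 3"
proof -
  have int: "integrable std_gaussian (\<lambda>u :: real ^ 'n. (axis i 1 \<bullet> u) ^ 6)" for i
    by (intro integrable_exp_bounded exp_bounded_intros) measurable
  have "(LINT u|std_gaussian. (norm (u :: real ^ 'n)) ^ 6) \<le>
      (LINT u|std_gaussian. (real CARD('n))\<^sup>2 * (\<Sum>i\<in>UNIV. (axis i 1 \<bullet> (u :: real ^ 'n)) ^ 6))"
  proof (rule integral_mono)
    show "integrable std_gaussian (\<lambda>u :: real ^ 'n. norm u ^ 6)"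
      by (intro integrable_exp_bounded exp_bounded_intros) measurable
    show "integrable std_gaussian (\<lambda>u :: real ^ 'n. (real CARD('n))\<^sup>2 * (\<Sum>i\<in>UNIV. (axis i 1 \<bullet> u) ^ 6))"
      using int by auto
    fix u :: "real ^ 'n"
    have "norm u ^ 6 = ((norm u)\<^sup>2) ^ 3" by (simp add: power_mult[symmetric])
    also have "\<dots> \<le> (real CARD('n))\<^sup>2 * (\<Sum>i\<in>UNIV. ((axis i 1 \<bullet> u)\<^sup>2) ^ 3)"
      unfolding norm_power2_vec by (rule sum_cubed_le) auto
    finally show "norm u ^ 6 \<le> (real CARD('n))\<^sup>2 * (\<Sum>i\<in>UNIV. (axis i 1 \<bullet> u) ^ 6)"
      by (simp add: power_mult[symmetric])
  qed
  also have "\<dots> = 15 * real CARD('n) ^ 3"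
    using int by (simp add: std_gaussian_moment_6) (simp add: power2_eq_square power3_eq_cube)
  finally show ?thesis .
qed

text \<open>The function \<open>(v \<bullet> u) * (norm u)^2\<close> is translated along
  \<open>v\<close>, and the mean is a cubic in \<open>h\<close>. Its linear coefficient is the mean
  of \<open>2 * (v \<bullet> u)^2 + (norm v)^2 * (norm u)^2\<close>, where the first term
  contributes 2 and the second the dimension. The quadratic coefficient has mean zero.\<close>

lemma std_gaussian_inner_norm_moment:
  fixes v :: "real ^ 'n"
  shows "(LINT u|std_gaussian. (v \<bullet> u)\<^sup>2 * (norm u)\<^sup>2) = (real CARD('n) + 2) * (norm v)\<^sup>2"
proof -
  let ?E = "\<lambda>g :: real ^ 'n \<Rightarrow> real. LINT u|std_gaussian. g u"
  interpret prob_space "std_gaussian :: (real ^ 'n) measure" by (rule prob_space_std_gaussian)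
  have int1: "integrable std_gaussian (\<lambda>u. v \<bullet> u)"
    by (intro integrable_exp_bounded exp_bounded_intros) measurable
  have int2: "integrable std_gaussian (\<lambda>u. (v \<bullet> u)\<^sup>2)"
    by (intro integrable_exp_bounded exp_bounded_intros) measurable
  have int3: "integrable std_gaussian (\<lambda>u :: real ^ 'n. (norm u)\<^sup>2)"
    by (intro integrable_exp_bounded exp_bounded_intros) measurable
  have int4: "integrable std_gaussian (\<lambda>u. (v \<bullet> u) * (norm u)\<^sup>2)"
    by (intro integrable_exp_bounded exp_bounded_intros) measurable
  let ?b = "(norm v)\<^sup>2"
  have "?E (\<lambda>u. (v \<bullet> (u + h *\<^sub>R v)) * (norm (u + h *\<^sub>R v))\<^sup>2) =
      ?E (\<lambda>u. (v \<bullet> u) * (norm u)\<^sup>2) + h * ((real CARD('n) + 2) * ?b) + h ^ 3 * ?b\<^sup>2" for h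
  proof -
    have "(v \<bullet> (u + h *\<^sub>R v)) * (norm (u + h *\<^sub>R v))\<^sup>2 =
        (v \<bullet> u) * (norm u)\<^sup>2 + (2 * h * (v \<bullet> u)\<^sup>2 + (h * ?b * (norm u)\<^sup>2
          + (3 * h\<^sup>2 * ?b * (v \<bullet> u) + h ^ 3 * ?b\<^sup>2)))" for u
      by (simp add: power2_norm_eq_inner inner_add inner_commute) algebra
    then show ?thesis
      using int1 int2 int3 int4 prob_space
      by (simp add: std_gaussian_moment_1 std_gaussian_moment_2 std_gaussian_norm_power2)
        (simp add: algebra_simps)
  qed
  moreover have "DERIV (\<lambda>h. ?E (\<lambda>u. (v \<bullet> (u + h *\<^sub>R v)) * (norm (u + h *\<^sub>R v))\<^sup>2)) 0 :>
      ?E (\<lambda>u. ((v \<bullet> u) * (norm u)\<^sup>2) * (v \<bullet> u))"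
    by (intro DERIV_std_gaussian_shift[where g = "\<lambda>u. (v \<bullet> u) * (norm u)\<^sup>2"] exp_bounded_intros)
      measurable
  moreover have "DERIV (\<lambda>h. ?E (\<lambda>u. (v \<bullet> u) * (norm u)\<^sup>2) + h * ((real CARD('n) + 2) * ?b)
      + h ^ 3 * ?b\<^sup>2) 0 :> (real CARD('n) + 2) * ?b"
    by (auto intro!: derivative_eq_intros)
  ultimately have "?E (\<lambda>u. ((v \<bullet> u) * (norm u)\<^sup>2) * (v \<bullet> u)) = (real CARD('n) + 2) * ?b"
    using DERIV_unique by fastforce
  then show ?thesis by (simp add: power2_eq_square ac_simps)
qed

text \<open>Expanding the square gives means 1, -2 and d + 2 in units of \<open>(norm v)^2\<close>,
  where d is the dimension.\<close>

lemma std_gaussian_rank_one_residual: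
  fixes v :: "real ^ 'n"
  shows "(LINT u|std_gaussian. (norm (v - (v \<bullet> u) *\<^sub>R u))\<^sup>2) = (real CARD('n) + 1) * (norm v)\<^sup>2"
proof -
  interpret prob_space "std_gaussian :: (real ^ 'n) measure" by (rule prob_space_std_gaussian)
  have int1: "integrable std_gaussian (\<lambda>u. (v \<bullet> u)\<^sup>2)"
    by (intro integrable_exp_bounded exp_bounded_intros) measurable
  have int2: "integrable std_gaussian (\<lambda>u. (v \<bullet> u)\<^sup>2 * (norm u)\<^sup>2)"
    by (intro integrable_exp_bounded exp_bounded_intros) measurable
  have eq: "(norm (v - (v \<bullet> u) *\<^sub>R u))\<^sup>2 =
      (norm v)\<^sup>2 - 2 * (v \<bullet> u)\<^sup>2 + (v \<bullet> u)\<^sup>2 * (norm u)\<^sup>2" for u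
    by (simp add: power2_norm_eq_inner inner_diff inner_commute) algebra
  show ?thesis
    unfolding eq using int1 int2 prob_space
    by (simp add: std_gaussian_moment_2 std_gaussian_inner_norm_moment) (simp add: algebra_simps)
qed

subsection \<open>The gradient estimator\<close>

text \<open>The integrability and differentiability conjuncts give content to the other two: a
  Bochner integral defaults to 0 for a non-integrable function, and \<open>grad\<close> is
  unspecified where no gradient exists.\<close>

theorem lemma3p3:
  fixes f :: "real ^ 'n \<Rightarrow> real" and B L \<tau> :: real and x m :: "real ^ 'n"
  assumes "\<And>y. f differentiable (at y)"
    and "B_Lipschitz B f"
    and "L_smooth L f"
    and "\<tau> > 0"
  shows "(\<forall>y. integrable std_gaussian (\<lambda>u. f (y + \<tau> *\<^sub>R u)))
    \<and> gauss_smoothing f \<tau> differentiable (at x)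
    \<and> integrable std_gaussian (\<lambda>u. G_est f \<tau> x m u)
    \<and> (LINT u|std_gaussian. G_est f \<tau> x m u) = grad (gauss_smoothing f \<tau>) x
    \<and> integrable std_gaussian (\<lambda>u. (norm (G_est f \<tau> x m u - grad f x))\<^sup>2)
    \<and> (LINT u|std_gaussian. (norm (G_est f \<tau> x m u - grad f x))\<^sup>2)
        \<le> 2 * (real CARD('n) + 1) * (norm (m - grad f x))\<^sup>2
          + 8 * \<tau>\<^sup>2 * L\<^sup>2 * real CARD('n) ^ 3"
proof -
  interpret prob_space "std_gaussian :: (real ^ 'n) measure" by (rule prob_space_std_gaussian)
  have smooth: "\<bar>f z - f y - grad f y \<bullet> (z - y)\<bar> \<le> L / 2 * (norm (z - y))\<^sup>2" for y z
    using assms(3) unfolding L_smooth_def by blast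
  have [measurable]: "f \<in> borel_measurable borel"
    using assms(1) by (intro borel_measurable_continuous_onI)
      (simp add: continuous_on_eq_continuous_at differentiable_imp_continuous_within)
  \<comment> \<open>Smoothness at the base point 0 bounds \<open>f\<close> by a quadratic in
    \<open>norm z\<close>.\<close>
  have "exp_bounded (\<lambda>z. \<bar>f 0\<bar> + norm (grad f 0) * norm z + \<bar>L / 2\<bar> * (norm z)\<^sup>2)"
    by (intro exp_bounded_intros)
  then have f_bd: "exp_bounded f"
  proof (rule exp_bounded_mono)
    fix z
    have "\<bar>grad f 0 \<bullet> z\<bar> \<le> norm (grad f 0) * norm z" by (rule Cauchy_Schwarz_ineq2)
    moreover have "L / 2 * (norm z)\<^sup>2 \<le> \<bar>L / 2\<bar> * (norm z)\<^sup>2"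
      by (intro mult_right_mono) auto
    moreover have "\<bar>f z - f 0 - grad f 0 \<bullet> z\<bar> \<le> L / 2 * (norm z)\<^sup>2"
      using smooth[of z 0] by simp
    ultimately have "\<bar>f z\<bar> \<le> \<bar>f 0\<bar> + norm (grad f 0) * norm z + \<bar>L / 2\<bar> * (norm z)\<^sup>2"
      by linarith
    then show "norm (f z) \<le> norm (\<bar>f 0\<bar> + norm (grad f 0) * norm z + \<bar>L / 2\<bar> * (norm z)\<^sup>2)"
      by simp
  qed
  have g_bd: "exp_bounded (\<lambda>u. f (y + \<tau> *\<^sub>R u))" for y
    by (rule exp_bounded_affine[OF f_bd])
  have int_f: "integrable std_gaussian (\<lambda>u. f (y + \<tau> *\<^sub>R u))" for y
    by (intro integrable_exp_bounded g_bd) measurable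

  let ?D = "LINT u|std_gaussian. f (x + \<tau> *\<^sub>R u) *\<^sub>R u"
  have int_D: "integrable std_gaussian (\<lambda>u. f (x + \<tau> *\<^sub>R u) *\<^sub>R u)"
    by (intro integrable_exp_bounded exp_bounded_intros g_bd) measurable
  \<comment> \<open>Moving the base point from \<open>x\<close> to \<open>y\<close> amounts to
    translating the Gaussian by \<open>(y - x) / \<tau>\<close>; the chain rule contributes the
    factor \<open>1 / \<tau>\<close>.\<close>
  have gd: "GDERIV (gauss_smoothing f \<tau>) x :> (1 / \<tau>) *\<^sub>R ?D"
  proof -
    let ?F = "\<lambda>w. LINT u|std_gaussian. f (x + \<tau> *\<^sub>R (u + w))"
    \<comment> \<open>The point 0 is written as the value at \<open>x\<close> of the inner map, as
      the chain rule expects.\<close>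
    have "(?F has_derivative (\<lambda>h. h \<bullet> ?D)) (at ((1 / \<tau>) *\<^sub>R (x - x)))"
      using GDERIV_std_gaussian_shift[OF _ g_bd, of x] by (simp add: gderiv_def)
    moreover have "((\<lambda>y. (1 / \<tau>) *\<^sub>R (y - x)) has_derivative (\<lambda>h. (1 / \<tau>) *\<^sub>R h)) (at x)"
      by (auto intro!: derivative_eq_intros)
    ultimately have "((\<lambda>y. ?F ((1 / \<tau>) *\<^sub>R (y - x))) has_derivative
        (\<lambda>h. ((1 / \<tau>) *\<^sub>R h) \<bullet> ?D)) (at x)"
      by (rule has_derivative_compose[rotated])
    moreover have "?F ((1 / \<tau>) *\<^sub>R (y - x)) = gauss_smoothing f \<tau> y" for y
      using assms(4) by (simp add: gauss_smoothing_def scaleR_add_right algebra_simps)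
    ultimately show ?thesis by (simp add: gderiv_def)
  qed
  then have grad: "grad (gauss_smoothing f \<tau>) x = (1 / \<tau>) *\<^sub>R ?D"
    by (rule grad_eqI)

  have G_bd: "exp_bounded (G_est f \<tau> x m)"
    unfolding G_est_def divide_inverse by (intro exp_bounded_intros g_bd)
  have [measurable]: "G_est f \<tau> x m \<in> borel_measurable borel"
    unfolding G_est_def by measurable
  have int_G: "integrable std_gaussian (G_est f \<tau> x m)"
    by (intro integrable_exp_bounded G_bd) measurable
  have EG: "(LINT u|std_gaussian. G_est f \<tau> x m u) = (1 / \<tau>) *\<^sub>R ?D"
  \<comment> \<open>Testing against every \<open>w\<close> reduces the vector identity to scalar
    moments.\<close>
  proof (subst vector_eq_ldot[symmetric], intro allI)
    fix w :: "real ^ 'n"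
    have int1: "integrable std_gaussian (\<lambda>u. w \<bullet> u)"
      by (intro integrable_exp_bounded exp_bounded_intros) measurable
    have int2: "integrable std_gaussian (\<lambda>u. (m \<bullet> u) * (w \<bullet> u))"
      by (intro integrable_exp_bounded exp_bounded_intros) measurable
    have int3: "integrable std_gaussian (\<lambda>u. f (x + \<tau> *\<^sub>R u) * (w \<bullet> u))"
      by (intro integrable_exp_bounded exp_bounded_intros g_bd) measurable
    have "w \<bullet> (LINT u|std_gaussian. G_est f \<tau> x m u) = (LINT u|std_gaussian. w \<bullet> G_est f \<tau> x m u)"
      using int_G by (subst integral_inner_right[symmetric]) simp_all
    also have "\<dots> = (LINT u|std_gaussian. w \<bullet> m + ((1 / \<tau>) * (f (x + \<tau> *\<^sub>R u) * (w \<bullet> u))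
        - (f x / \<tau>) * (w \<bullet> u) - (m \<bullet> u) * (w \<bullet> u)))"
      using assms(4) by (intro Bochner_Integration.integral_cong refl)
        (simp add: G_est_def inner_add_right field_simps)
    \<comment> \<open>The \<open>f x\<close> term vanishes by the first moment, and the covariance
      term cancels \<open>w \<bullet> m\<close>.\<close>
    also have "\<dots> = (1 / \<tau>) * (LINT u|std_gaussian. f (x + \<tau> *\<^sub>R u) * (w \<bullet> u))"
      using int1 int2 int3 prob_space
      by (simp add: std_gaussian_moment_1 std_gaussian_covariance inner_commute[of w m])
    also have "(LINT u|std_gaussian. f (x + \<tau> *\<^sub>R u) * (w \<bullet> u)) = w \<bullet> ?D"
      using int_D by (subst integral_inner_right[symmetric]) simp_all
    finally show "w \<bullet> (LINT u|std_gaussian. G_est f \<tau> x m u) = w \<bullet> ((1 / \<tau>) *\<^sub>R ?D)"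
      by simp
  qed

  let ?v = "m - grad f x"
  have int_err: "integrable std_gaussian (\<lambda>u. (norm (G_est f \<tau> x m u - grad f x))\<^sup>2)"
    by (intro integrable_exp_bounded exp_bounded_intros G_bd) measurable
  have int_v: "integrable std_gaussian (\<lambda>u. (norm (?v - (?v \<bullet> u) *\<^sub>R u))\<^sup>2)"
    by (intro integrable_exp_bounded exp_bounded_intros) measurable
  have int_6: "integrable std_gaussian (\<lambda>u :: real ^ 'n. norm u ^ 6)"
    by (intro integrable_exp_bounded exp_bounded_intros) measurable
  have "(LINT u|std_gaussian. (norm (G_est f \<tau> x m u - grad f x))\<^sup>2) \<le>
      (LINT u|std_gaussian. 2 * (norm (?v - (?v \<bullet> u) *\<^sub>R u))\<^sup>2 + (\<tau>\<^sup>2 * L\<^sup>2 / 2) * norm u ^ 6)"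
  proof (rule integral_mono[OF int_err])
    show "integrable std_gaussian
        (\<lambda>u. 2 * (norm (?v - (?v \<bullet> u) *\<^sub>R u))\<^sup>2 + (\<tau>\<^sup>2 * L\<^sup>2 / 2) * norm u ^ 6)"
      using int_v int_6 by simp
    fix u :: "real ^ 'n"
    \<comment> \<open>The first-order Taylor remainder of \<open>f\<close> at \<open>x\<close>,
      divided by \<open>\<tau>\<close>: the quotient in the estimator with \<open>m\<close> replaced
      by the true gradient.\<close>
    define r where "r = (f (x + \<tau> *\<^sub>R u) - f x - grad f x \<bullet> (\<tau> *\<^sub>R u)) / \<tau>"
    have "\<bar>r\<bar> \<le> \<tau> * L / 2 * (norm u)\<^sup>2"
      using smooth[of "x + \<tau> *\<^sub>R u" x] assms(4)
      by (simp add: r_def abs_div power2_eq_square field_simps)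
    then have "r\<^sup>2 \<le> (\<tau> * L / 2 * (norm u)\<^sup>2)\<^sup>2"
      by (metis abs_ge_zero power2_abs power_mono)
    then have "r\<^sup>2 * (norm u)\<^sup>2 \<le> (\<tau> * L / 2 * (norm u)\<^sup>2)\<^sup>2 * (norm u)\<^sup>2"
      by (rule mult_right_mono) simp
    also have "\<dots> = \<tau>\<^sup>2 * L\<^sup>2 / 4 * norm u ^ 6"
      by (simp add: power_mult_distrib power_divide eval_nat_numeral)
    finally have r: "(norm (r *\<^sub>R u))\<^sup>2 \<le> \<tau>\<^sup>2 * L\<^sup>2 / 4 * norm u ^ 6"
      by (simp add: power_mult_distrib)
    have "G_est f \<tau> x m u - grad f x = (?v - (?v \<bullet> u) *\<^sub>R u) + r *\<^sub>R u"
    proof -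
      have "(f (x + \<tau> *\<^sub>R u) - f x - m \<bullet> (\<tau> *\<^sub>R u)) / \<tau> = r - ?v \<bullet> u"
        using assms(4) by (simp add: r_def inner_diff_left field_simps)
      then show ?thesis by (simp add: G_est_def scaleR_diff_left)
    qed
    \<comment> \<open>Source of the factor 2 in the final bound; it also turns the 1/4 in the bound
      on the remainder term into 1/2.\<close>
    moreover have "(norm (a + b))\<^sup>2 \<le> 2 * (norm a)\<^sup>2 + 2 * (norm b)\<^sup>2" for a b :: "real ^ 'n"
      using zero_le_power2[of "norm (a - b)"]
      by (simp add: power2_norm_eq_inner inner_add inner_diff inner_commute)
    ultimately have "(norm (G_est f \<tau> x m u - grad f x))\<^sup>2 \<le>
        2 * (norm (?v - (?v \<bullet> u) *\<^sub>R u))\<^sup>2 + 2 * (norm (r *\<^sub>R u))\<^sup>2"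
      by presburger
    with r show "(norm (G_est f \<tau> x m u - grad f x))\<^sup>2 \<le>
        2 * (norm (?v - (?v \<bullet> u) *\<^sub>R u))\<^sup>2 + (\<tau>\<^sup>2 * L\<^sup>2 / 2) * norm u ^ 6"
      by linarith
  qed
  also have "\<dots> = 2 * (real CARD('n) + 1) * (norm ?v)\<^sup>2 +
      (\<tau>\<^sup>2 * L\<^sup>2 / 2) * (LINT u|std_gaussian. norm (u :: real ^ 'n) ^ 6)"
    using int_v int_6 by (simp add: std_gaussian_rank_one_residual)
  \<comment> \<open>The moment constant 15 is relaxed to 16, whose half is the 8 of the
    claim.\<close>
  also have "(\<tau>\<^sup>2 * L\<^sup>2 / 2) * (LINT u|std_gaussian. norm (u :: real ^ 'n) ^ 6)
      \<le> (\<tau>\<^sup>2 * L\<^sup>2 / 2) * (16 * real CARD('n) ^ 3)"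
  proof (rule mult_left_mono)
    have "0 \<le> real CARD('n) ^ 3" by simp
    then show "(LINT u|std_gaussian. norm (u :: real ^ 'n) ^ 6) \<le> 16 * real CARD('n) ^ 3"
      using std_gaussian_norm_power6_le[where 'n = 'n] by linarith
  qed simp
  finally have bound: "(LINT u|std_gaussian. (norm (G_est f \<tau> x m u - grad f x))\<^sup>2)
      \<le> 2 * (real CARD('n) + 1) * (norm ?v)\<^sup>2 + 8 * \<tau>\<^sup>2 * L\<^sup>2 * real CARD('n) ^ 3"
    by (simp add: mult_ac)
  have "gauss_smoothing f \<tau> differentiable (at x)"
    using gd unfolding gderiv_def differentiable_def by blast
  with int_f int_G EG grad int_err bound show ?thesis by simp
qed

end
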